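(* Let $V:S^1\to S^1$ be a $b$-bistochastic quadratic stochastic operator with heredity coefficients $\{P_{ij,k}\}_{i,j,k=1}^2$. Then $V$ is a strict contraction if and only if $$\max\{P_{12,1};\ |P_{11,1}-P_{12,1}|\}<\tfrac12.$$
   Context: $S^{n-1}=\{\mathbf{x}=(x_1,\dots,x_n)\in\mathbb{R}^n : x_i\ge 0,\ \sum_{i=1}^n x_i=1\}$ (here $n=2$). For $\mathbf{x},\mathbf{y}\in S^{n-1}$ write $\mathbf{x}\le^b\mathbf{y}$ if $\sum_{i=1}^k x_i\le\sum_{i=1}^k y_i$ for all $k\in\{1,\dots,n-1\}$. A quadratic stochastic operator (q.s.o.) is a map $V:S^{n-1}\to S^{n-1}$ of the form $V(\mathbf{x})_k=\sum_{i,j=1}^n P_{ij,k}x_ix_j$, $k=1,\dots,n$, where the heredity coefficients satisfy $P_{ij,k}\ge 0$, $P_{ij,k}=P_{ji,k}$ and $\sum_{k=1}^n P_{ij,k}=1$ for all $i,j,k$. A q.s.o. $V$ is called $b$-bistochastic if $V(\mathbf{x})\le^b\mathbf{x}$ for all $\mathbf{x}\in S^{n-1}$. $V$ is a strict contraction if there exists $\alpha\in[0,1)$ such that $\|V(\mathbf{x})-V(\mathbf{y})\|\le\alpha\|\mathbf{x}-\mathbf{y}\|$ for all $\mathbf{x},\mathbf{y}\in S^{n-1}$, where $\|\mathbf{x}\|=\sum_{i=1}^n|x_i|$. *)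

theory Defs
  imports Complex_Main "HOL-Library.FuncSet"
begin

text \<open>
  A vector of \<open>\<real>\<^sup>n\<close> is a function on the index set \<open>{1..n}\<close>, extended by \<open>undefined\<close> elsewhere
  (\<open>\<rightarrow>\<^sub>E\<close>), so that points of the simplex are equal iff their \<open>n\<close> coordinates agree.
  The coefficient \<open>P\<^bsub>ij,k\<^esub>\<close> is written \<open>P i j k\<close>; only its values at indices in \<open>{1..n}\<close> matter.
\<close>

definition simplex :: "nat \<Rightarrow> (nat \<Rightarrow> real) set" where
  "simplex n = {x \<in> {1..n} \<rightarrow>\<^sub>E {0..}. (\<Sum>i=1..n. x i) = 1}"

definition b_le :: "nat \<Rightarrow> (nat \<Rightarrow> real) \<Rightarrow> (nat \<Rightarrow> real) \<Rightarrow> bool" where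
  "b_le n x y \<longleftrightarrow> (\<forall>k\<in>{1..<n}. (\<Sum>i=1..k. x i) \<le> (\<Sum>i=1..k. y i))"

definition heredity :: "nat \<Rightarrow> (nat \<Rightarrow> nat \<Rightarrow> nat \<Rightarrow> real) \<Rightarrow> bool" where
  "heredity n P \<longleftrightarrow>
     (\<forall>i\<in>{1..n}. \<forall>j\<in>{1..n}.
        (\<forall>k\<in>{1..n}. 0 \<le> P i j k \<and> P i j k = P j i k) \<and> (\<Sum>k=1..n. P i j k) = 1)"

definition qso :: "nat \<Rightarrow> (nat \<Rightarrow> nat \<Rightarrow> nat \<Rightarrow> real) \<Rightarrow> ((nat \<Rightarrow> real) \<Rightarrow> (nat \<Rightarrow> real)) \<Rightarrow> bool" where
  "qso n P V \<longleftrightarrow>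
     heredity n P \<and> V \<in> simplex n \<rightarrow> simplex n \<and>
     (\<forall>x\<in>simplex n. \<forall>k\<in>{1..n}. V x k = (\<Sum>i=1..n. \<Sum>j=1..n. P i j k * x i * x j))"

definition b_bistochastic :: "nat \<Rightarrow> ((nat \<Rightarrow> real) \<Rightarrow> (nat \<Rightarrow> real)) \<Rightarrow> bool" where
  "b_bistochastic n V \<longleftrightarrow> (\<forall>x\<in>simplex n. b_le n (V x) x)"

definition norm1 :: "nat \<Rightarrow> (nat \<Rightarrow> real) \<Rightarrow> real" where
  "norm1 n x = (\<Sum>i=1..n. \<bar>x i\<bar>)"

definition strict_contraction :: "nat \<Rightarrow> ((nat \<Rightarrow> real) \<Rightarrow> (nat \<Rightarrow> real)) \<Rightarrow> bool" where
  "strict_contraction n V \<longleftrightarrow>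
     (\<exists>\<alpha>::real. 0 \<le> \<alpha> \<and> \<alpha> < 1 \<and>
        (\<forall>x\<in>simplex n. \<forall>y\<in>simplex n.
           norm1 n (\<lambda>i. V x i - V y i) \<le> \<alpha> * norm1 n (\<lambda>i. x i - y i)))"

end

(*
  In the coordinate t = x_1 the operator is a quadratic map f of [0,1] and the l1 norm is twice the
  distance. Bistochasticity at t = 0 forces f(0) = P_{22,1} = 0, so with a = P_{11,1} and b = P_{12,1}
  the difference quotient of f at t, s is 2b + (a - 2b)(t + s). It is affine in t + s, which
  ranges over [0,2], hence is controlled by its end values 2b = f'(0) and 2(a - b) = f'(1).
*)
theory Submission
  imports Defs
begin

text \<open>The lower bound is written \<open>Suc 0\<close> because that is the simp normal form of
  \<open>1\<close>.\<close>

lemma sum_atLeastAtMost_1_2: "(\<Sum>i=Suc 0..2. g i) = g (Suc 0) + g 2"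
  for g :: "nat \<Rightarrow> 'a::comm_monoid_add"
  by (simp add: numeral_2_eq_2)

text \<open>Parametrises the simplex by its first coordinate. The restriction to
  \<open>{1..2}\<close> supplies the value \<open>undefined\<close> elsewhere that extensionality
  demands.\<close>

definition segment_point :: "real \<Rightarrow> nat \<Rightarrow> real" where
  "segment_point t = (\<lambda>i\<in>{1..2}. if i = 1 then t else 1 - t)"

lemma segment_point_simps [simp]:
  "segment_point t (Suc 0) = t" "segment_point t 2 = 1 - t"
  by (simp_all add: segment_point_def)

lemma segment_point_in_simplex:
  assumes "0 \<le> t" "t \<le> 1"
  shows "segment_point t \<in> simplex 2"
  using assms by (auto simp: simplex_def sum_atLeastAtMost_1_2 segment_point_def)

lemma simplex_2D:
  assumes "x \<in> simplex 2"
  shows "0 \<le> x 1" "x 1 \<le> 1" "x 2 = 1 - x 1"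
proof -
  have "x 1 \<ge> 0" "x 2 \<ge> 0"
    using assms by (auto simp: simplex_def PiE_iff)
  moreover have "x 1 + x 2 = 1"
    using assms by (simp add: simplex_def sum_atLeastAtMost_1_2)
  ultimately show "0 \<le> x 1" "x 1 \<le> 1" "x 2 = 1 - x 1"
    by auto
qed

text \<open>The coordinates sum to 1, so the second ones differ by exactly the negative of the first
  difference.\<close>

lemma norm1_diff_simplex_2:
  assumes "x \<in> simplex 2" "y \<in> simplex 2"
  shows "norm1 2 (\<lambda>i. x i - y i) = 2 * \<bar>x 1 - y 1\<bar>"
  using simplex_2D(3)[OF assms(1)] simplex_2D(3)[OF assms(2)]
  by (simp add: norm1_def sum_atLeastAtMost_1_2)

lemma qso_2_first_coordinate:
  assumes "qso 2 P V" "x \<in> simplex 2"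
  shows "V x 1 = P 1 1 1 * (x 1)\<^sup>2 + 2 * P 1 2 1 * x 1 * (1 - x 1) + P 2 2 1 * (1 - x 1)\<^sup>2"
proof -
  have "P 2 1 1 = P 1 2 1"
    using assms(1) by (auto simp: qso_def heredity_def)
  moreover have "V x 1 = (\<Sum>i=1..2. \<Sum>j=1..2. P i j 1 * x i * x j)"
    using assms by (auto simp: qso_def)
  ultimately show ?thesis
    using simplex_2D(3)[OF assms(2)]
    by (simp add: sum_atLeastAtMost_1_2 power2_eq_square algebra_simps)
qed

lemma b_bistochastic_2_imp_P221_zero:
  assumes "qso 2 P V" "b_bistochastic 2 V"
  shows "P 2 2 1 = 0"
proof -
  have e: "segment_point 0 \<in> simplex 2"
    by (rule segment_point_in_simplex) auto
  then have "b_le 2 (V (segment_point 0)) (segment_point 0)"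
    using assms(2) by (auto simp: b_bistochastic_def)
  \<comment> \<open>For n = 2 the b-order consists of the single inequality at k = 1.\<close>
  then have "V (segment_point 0) 1 \<le> 0"
    by (simp add: b_le_def numeral_2_eq_2)
  moreover have "V (segment_point 0) 1 = P 2 2 1"
    using qso_2_first_coordinate[OF assms(1) e] by simp
  moreover have "P 2 2 1 \<ge> 0"
    using assms(1) by (auto simp: qso_def heredity_def)
  ultimately show ?thesis by simp
qed

text \<open>By continuity from the right. Contraction bounds difference quotients only at distinct
  points, so the slopes at the ends of the segment are reached only as limits.\<close>

lemma abs_affine_bound_at_0:
  fixes q :: real
  assumes "\<And>h. 0 < h \<Longrightarrow> h \<le> 1 \<Longrightarrow> \<bar>q + p * h\<bar> \<le> B"
  shows "\<bar>q\<bar> \<le> B"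
proof (rule tendsto_upperbound)
  show "((\<lambda>h. \<bar>q + p * h\<bar>) \<longlongrightarrow> \<bar>q\<bar>) (at_right 0)"
    by (auto intro!: tendsto_eq_intros)
  show "\<forall>\<^sub>F h in at_right 0. \<bar>q + p * h\<bar> \<le> B"
    unfolding eventually_at_right_field using assms by (intro exI[of _ 1]) auto
\<comment> \<open>What remains is that \<open>at_right 0\<close> is a nontrivial filter.\<close>
qed simp

lemma abs_affine_le_max_endpoints:
  fixes a b u :: real
  assumes "0 \<le> u" "u \<le> 2"
  shows "\<bar>2 * b + (a - 2 * b) * u\<bar> \<le> 2 * max \<bar>b\<bar> \<bar>a - b\<bar>"
proof -
  \<comment> \<open>The nonnegative weights \<open>2 - u\<close> and \<open>u\<close> sum to 2, so
    this is twice a convex combination of \<open>b\<close> and \<open>a - b\<close>.\<close>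
  have "2 * b + (a - 2 * b) * u = (2 - u) * b + u * (a - b)"
    by (simp add: algebra_simps)
  also have "\<bar>\<dots>\<bar> \<le> (2 - u) * \<bar>b\<bar> + u * \<bar>a - b\<bar>"
    using assms abs_triangle_ineq[of "(2 - u) * b" "u * (a - b)"] by (simp add: abs_mult)
  also have "\<dots> \<le> (2 - u) * max \<bar>b\<bar> \<bar>a - b\<bar> + u * max \<bar>b\<bar> \<bar>a - b\<bar>"
    using assms by (intro add_mono mult_left_mono) auto
  finally show ?thesis
    by (simp add: algebra_simps)
qed

theorem theorem4p2:
  fixes P :: "nat \<Rightarrow> nat \<Rightarrow> nat \<Rightarrow> real"
    and V :: "(nat \<Rightarrow> real) \<Rightarrow> (nat \<Rightarrow> real)"
  assumes "qso 2 P V"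
    and "b_bistochastic 2 V"
  shows "strict_contraction 2 V \<longleftrightarrow> max (P 1 2 1) \<bar>P 1 1 1 - P 1 2 1\<bar> < 1 / 2"
proof -
  define a b where "a = P 1 1 1" and "b = P 1 2 1"
  define slope where "slope u = 2 * b + (a - 2 * b) * u" for u
  have b_nonneg: "b \<ge> 0"
    using assms(1) by (auto simp: qso_def heredity_def b_def)
  have V1: "V x 1 = a * (x 1)\<^sup>2 + 2 * b * x 1 * (1 - x 1)" if "x \<in> simplex 2" for x
    using qso_2_first_coordinate[OF assms(1) that] b_bistochastic_2_imp_P221_zero[OF assms]
    by (simp add: a_def b_def)
  have norm_V: "norm1 2 (\<lambda>i. V x i - V y i) = 2 * (\<bar>slope (x 1 + y 1)\<bar> * \<bar>x 1 - y 1\<bar>)"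
    if x: "x \<in> simplex 2" and y: "y \<in> simplex 2" for x y
  proof -
    have "V x \<in> simplex 2" "V y \<in> simplex 2"
      using assms(1) x y by (auto simp: qso_def)
    then have "norm1 2 (\<lambda>i. V x i - V y i) = 2 * \<bar>V x 1 - V y 1\<bar>"
      by (rule norm1_diff_simplex_2)
    \<comment> \<open>The factor \<open>x 1 + y 1\<close> comes from the difference of the squares
      of the first coordinates.\<close>
    also have "V x 1 - V y 1 = slope (x 1 + y 1) * (x 1 - y 1)"
      unfolding V1[OF x] V1[OF y] slope_def by (simp add: power2_eq_square algebra_simps)
    finally show ?thesis
      by (simp add: abs_mult)
  qed
  have "strict_contraction 2 V \<longleftrightarrow> max b \<bar>a - b\<bar> < 1 / 2"
  proof
    assume "strict_contraction 2 V"
    then obtain \<alpha> where "\<alpha> < 1" and contr: "\<And>x y. x \<in> simplex 2 \<Longrightarrow> y \<in> simplex 2 \<Longrightarrow>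
        norm1 2 (\<lambda>i. V x i - V y i) \<le> \<alpha> * norm1 2 (\<lambda>i. x i - y i)"
      unfolding strict_contraction_def by blast
    \<comment> \<open>Strictness of s < t allows the positive factor \<open>t - s\<close> to be
      cancelled.\<close>
    have slope_le: "\<bar>slope (t + s)\<bar> \<le> \<alpha>" if "0 \<le> s" "s < t" "t \<le> 1" for s t
    proof -
      have in_simplex: "segment_point t \<in> simplex 2" "segment_point s \<in> simplex 2"
        using that by (auto intro: segment_point_in_simplex)
      from contr[OF in_simplex] have "\<bar>slope (t + s)\<bar> * (t - s) \<le> \<alpha> * (t - s)"
        unfolding norm_V[OF in_simplex] norm1_diff_simplex_2[OF in_simplex] using that by (simp add: algebra_simps)
      with that show ?thesis by simp
    qed
    \<comment> \<open>Uses the pairs h, 0, whose coordinate sum tends to 0.\<close>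
    have "\<bar>2 * b\<bar> \<le> \<alpha>"
    proof (rule abs_affine_bound_at_0)
      show "\<bar>2 * b + (a - 2 * b) * h\<bar> \<le> \<alpha>" if "0 < h" "h \<le> 1" for h
        using slope_le[of 0 h] that by (simp add: slope_def)
    qed
    \<comment> \<open>Uses the pairs 1, 1 - h: the coordinate sum 2 - h tends to 2, and expanding
      \<open>slope (2 - h)\<close> in h gives the affine form below.\<close>
    moreover have "\<bar>2 * (a - b)\<bar> \<le> \<alpha>"
    proof (rule abs_affine_bound_at_0)
      show "\<bar>2 * (a - b) + (2 * b - a) * h\<bar> \<le> \<alpha>" if "0 < h" "h \<le> 1" for h
        using slope_le[of "1 - h" 1] that by (simp add: slope_def algebra_simps)
    qed
    ultimately show "max b \<bar>a - b\<bar> < 1 / 2"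
      using \<open>\<alpha> < 1\<close> unfolding max_less_iff_conj abs_mult by simp
  next
    assume less: "max b \<bar>a - b\<bar> < 1 / 2"
    show "strict_contraction 2 V"
      unfolding strict_contraction_def
    \<comment> \<open>The constant is the larger absolute value of the two end slopes; the
      hypothesis says precisely that it is below 1.\<close>
    proof (intro exI[of _ "2 * max b \<bar>a - b\<bar>"] conjI ballI)
      fix x y
      assume x: "x \<in> simplex 2" and y: "y \<in> simplex 2"
      \<comment> \<open>Both first coordinates lie in [0,1], so their sum lies in [0,2];
        \<open>b_nonneg\<close> turns \<bar>b\<bar> into \<open>b\<close>.\<close>
      have "\<bar>slope (x 1 + y 1)\<bar> \<le> 2 * max b \<bar>a - b\<bar>"
        using abs_affine_le_max_endpoints[of "x 1 + y 1" b a] simplex_2D[OF x] simplex_2D[OF y]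
          b_nonneg by (simp add: slope_def)
      then have "\<bar>slope (x 1 + y 1)\<bar> * \<bar>x 1 - y 1\<bar> \<le> 2 * max b \<bar>a - b\<bar> * \<bar>x 1 - y 1\<bar>"
        by (rule mult_right_mono) simp
      then show "norm1 2 (\<lambda>i. V x i - V y i) \<le> 2 * max b \<bar>a - b\<bar> * norm1 2 (\<lambda>i. x i - y i)"
        unfolding norm_V[OF x y] norm1_diff_simplex_2[OF x y] by linarith
    qed (use less b_nonneg in auto)
  qed
  then show ?thesis
    by (simp only: a_def b_def)
qed

end
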